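(* Let $\mathbf{x}\in L^2(\mathbb{R})$, let $k\in\mathbb{Q}^+$ and let $\theta\in\mathbb{R}$ with $\theta\notin\pi\mathbb{Z}$. Then the new fractional ambiguity function has the time marginal property $$\int_{\mathbb{R}}\mathcal{A}^{\theta,k}_{\mathbf{x}}(\tau,u)\,du=\mathbf{x}\left(k\tfrac{\tau}{2}\right)\mathbf{x}^*\left(-k\tfrac{\tau}{2}\right).$$
   Context: Superscript $*$ denotes complex conjugation. $\Omega_\theta=\sqrt{(1-i\cot\theta)/2\pi}$, so $|\Omega_\theta|^2=|\csc\theta|/(2\pi)$. The new fractional ambiguity function (NFrAF) of $\mathbf{x}\in L^2(\mathbb{R})$ with parameters $(\theta,k)$ is $$\mathcal{A}^{\theta,k}_{\mathbf{x}}(\tau,u)=|\Omega_\theta|^2\int_{\mathbb{R}}\mathbf{x}\left(t+k\tfrac{\tau}{2}\right)\mathbf{x}^*\left(t-k\tfrac{\tau}{2}\right)e^{it(k\tau\cot\theta-u\csc\theta)}\,dt.$$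
   Formalization: The integral over u need not exist for x in L² (e.g. an indicator), so the identity is proved for almost every τ: as a Lebesgue or symmetric improper integral whenever that exists, and always as an Abel-regularized integral. *)

theory Defs
  imports "HOL-Analysis.Analysis"
begin

text \<open>A signal in \<open>L\<^sup>2(\<real>)\<close>, given by a representative. Two representatives of the same class
  agree only almost everywhere, so point values of a signal are meaningful only up to null sets.\<close>

definition square_integrable :: "(real \<Rightarrow> complex) \<Rightarrow> bool" where
  "square_integrable x \<longleftrightarrow>
     x \<in> borel_measurable lborel \<and> integrable lborel (\<lambda>t. (cmod (x t))\<^sup>2)"

text \<open>\<open>csqrt\<close> is the principal square root; only \<open>\<bar>Omega \<theta>\<bar>\<^sup>2\<close> is used, which does not depend on
  the branch.\<close>

definition Omega :: "real \<Rightarrow> complex" where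
  "Omega \<theta> = csqrt ((1 - \<i> * complex_of_real (cot \<theta>)) / complex_of_real (2 * pi))"

text \<open>Here \<open>1 / sin \<theta>\<close> is the cosecant. For square-integrable \<open>x\<close> the integrand is integrable for all
  \<open>\<tau>\<close> and \<open>u\<close>, by the Cauchy-Schwarz inequality.\<close>

definition NFrAF :: "real \<Rightarrow> real \<Rightarrow> (real \<Rightarrow> complex) \<Rightarrow> real \<Rightarrow> real \<Rightarrow> complex" where
  "NFrAF \<theta> k x \<tau> u =
     complex_of_real ((cmod (Omega \<theta>))\<^sup>2) *
     (LBINT t. x (t + k * (\<tau> / 2)) * cnj (x (t - k * (\<tau> / 2))) *
        exp (\<i> * complex_of_real (t * (k * \<tau> * cot \<theta> - u * (1 / sin \<theta>)))))"

text \<open>The function \<open>NFrAF \<theta> k x \<tau>\<close> need not be Lebesgue integrable (for the indicator of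
  an interval it decays like \<open>1/u\<close>), so two weaker senses of \<open>\<integral> f(u) du\<close> are needed: the improper
  integral as a symmetric limit, and the Abel-regularized integral that underlies the formal
  identity \<open>\<integral> exp(i u t) du = 2\<pi> \<delta>(t)\<close>.\<close>

definition has_improper_integral :: "(real \<Rightarrow> complex) \<Rightarrow> complex \<Rightarrow> bool" where
  "has_improper_integral f I \<longleftrightarrow>
     (\<forall>R. set_integrable lborel {-R..R} f) \<and>
     ((\<lambda>R. LBINT u:{-R..R}. f u) \<longlongrightarrow> I) at_top"

definition has_Abel_integral :: "(real \<Rightarrow> complex) \<Rightarrow> complex \<Rightarrow> bool" where
  "has_Abel_integral f I \<longleftrightarrow>
     (\<forall>\<epsilon>>0. integrable lborel (\<lambda>u. complex_of_real (exp (- \<epsilon> * \<bar>u\<bar>)) * f u)) \<and>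
     ((\<lambda>\<epsilon>. LBINT u. complex_of_real (exp (- \<epsilon> * \<bar>u\<bar>)) * f u) \<longlongrightarrow> I) (at_right 0)"

end

theory Submission
  imports Defs "HOL-Real_Asymp.Real_Asymp"
begin

text \<open>Completing the square removes the fractional parameter. With the chirped signal
  \<open>y(t) = x(t) exp(i cot \<theta> t\<^sup>2 / 2)\<close> and \<open>a = k \<tau> / 2\<close>, the phase \<open>exp(i t k \<tau> cot \<theta>)\<close> is absorbed into
  \<open>h(t) = y(a + t) cnj (y(-a + t))\<close>, and \<open>NFrAF \<theta> k x \<tau>\<close> becomes \<open>\<bar>c\<bar> / (2 \<pi>)\<close> times the Fourier integral of
  \<open>h\<close> at frequency \<open>c u\<close>, where \<open>c = 1 / sin \<theta>\<close> (\<open>NFrAF_eq_Fourier_chirp\<close>). Moreover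
  \<open>h(0) = x(a) cnj (x(-a))\<close>, so the claim is Fourier inversion for the integrable function \<open>h\<close> at the
  point \<open>0\<close>.

  By Fubini, Abel regularization turns the \<open>u\<close>-integral into a Poisson integral of \<open>h\<close>. That
  kernel is a superposition of indicators of symmetric intervals \<open>[-r, r]\<close>, so the Poisson integral is
  a weighted average of the means of \<open>h\<close> over such intervals (\<open>integral_radial_kernel\<close>). By dominated
  convergence it therefore tends to \<open>L\<close> as soon as these means tend to \<open>L\<close> for \<open>r \<rightarrow> 0\<close>
  (\<open>Poisson_kernel_tendsto\<close>, \<open>Fourier_has_Abel_integral\<close>).

  For almost every \<open>\<tau>\<close>, the symmetric means of \<open>y\<close> and of \<open>\<bar>y\<bar>\<^sup>2\<close> about both \<open>a\<close> and \<open>-a\<close> converge to the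
  values there, by Lebesgue's differentiation theorem. Expanding the square, the mean of
  \<open>\<bar>y(a + t) - y(a)\<bar>\<^sup>2\<close> then tends to \<open>0\<close>, and the means of the product \<open>h\<close> tend to \<open>h(0)\<close>
  (\<open>symmetric_mean_product_tendsto\<close>). This gives the Abel integral.

  An improper integral with value \<open>I\<close> has Abel limit \<open>I\<close>, by the same superposition argument for
  the kernel \<open>exp(-\<epsilon> \<bar>u\<bar>)\<close>, and the Lebesgue integral of an integrable function is an improper integral. So
  the other two senses of the integral can only give the same value.\<close>

section \<open>Integrals against radial kernels\<close>

text \<open>The fundamental theorem of calculus on a half-line, for a nonnegative derivative; integrability is
  part of the conclusion.\<close>

lemma has_bochner_integral_tail:
  fixes w F :: "real \<Rightarrow> real"
  assumes "w \<in> borel_measurable borel"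
    and "\<And>s. a \<le> s \<Longrightarrow> (F has_real_derivative w s) (at s)"
    and w: "\<And>s. a \<le> s \<Longrightarrow> 0 \<le> w s"
    and "(F \<longlongrightarrow> T) at_top"
  shows "has_bochner_integral lborel (\<lambda>s. indicator {a..} s * w s) (T - F a)"
proof (rule has_bochner_integral_nn_integral)
  have mono: "F a \<le> F s" if "a \<le> s" for s
    using assms(2) w that by (meson DERIV_nonneg_imp_nondecreasing)
  then have "F a \<le> T"
    by (intro tendsto_lowerbound[OF assms(4)] eventually_at_top_linorderI[of a]) auto
  then show "0 \<le> T - F a" by simp
  have "(\<integral>\<^sup>+s. ennreal (indicator {a..} s * w s) \<partial>lborel)
      = (\<integral>\<^sup>+s. ennreal (w s) * indicator {a..} s \<partial>lborel)"
    by (intro nn_integral_cong) (auto split: split_indicator)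
  also have "\<dots> = T - F a"
    by (rule nn_integral_FTC_atLeast) (use assms in auto)
  finally show "(\<integral>\<^sup>+s. ennreal (indicator {a..} s * w s) \<partial>lborel) = ennreal (T - F a)" .
  show "(\<lambda>s. indicator {a..} s * w s) \<in> borel_measurable lborel"
    using assms(1) by measurable
  show "AE s in lborel. 0 \<le> indicator {a..} s * w s"
    using w by (auto split: split_indicator)
qed

text \<open>Layer-cake formula. If \<open>K(a)\<close> is the integral of \<open>w \<ge> 0\<close> over \<open>[a, \<infinity>)\<close>, then the dilated kernel
  \<open>K(\<bar>t\<bar> / N)\<close> is the superposition, with weights \<open>w(s)\<close>, of the indicators of \<open>[-N s, N s]\<close>, and Fubini
  expresses the integral of \<open>f\<close> against it through the symmetric integrals of \<open>f\<close>.\<close>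

lemma integral_radial_kernel:
  fixes f :: "real \<Rightarrow> complex" and w K :: "real \<Rightarrow> real"
  assumes [measurable]: "f \<in> borel_measurable borel" "w \<in> borel_measurable borel"
    and w: "\<And>s. 0 \<le> s \<Longrightarrow> 0 \<le> w s"
    and K: "\<And>a. 0 \<le> a \<Longrightarrow> has_bochner_integral lborel (\<lambda>s. indicator {a..} s * w s) (K a)"
    and int: "integrable lborel (\<lambda>t. K (\<bar>t\<bar> / N) *\<^sub>R f t)"
    and N: "N > 0"
  shows "(LBINT t. K (\<bar>t\<bar> / N) *\<^sub>R f t)
       = (LBINT s. (indicator {0..} s * w s) *\<^sub>R (LBINT t:{- (N * s)..N * s}. f t))"
proof -
  define \<Phi> where "\<Phi> = (\<lambda>t s. (if \<bar>t\<bar> / N \<le> s then w s else 0) *\<^sub>R f t)"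
  have \<Phi>1: "\<Phi> t = (\<lambda>s. (indicator {\<bar>t\<bar> / N..} s * w s) *\<^sub>R f t)" for t
    by (auto simp: \<Phi>_def fun_eq_iff split: split_indicator)
  have \<Phi>2: "\<Phi> t s = (indicator {0..} s * w s) *\<^sub>R (indicator {- (N * s)..N * s} t *\<^sub>R f t)" for t s
  proof (cases "s \<ge> 0")
    case False
    moreover have "\<bar>t\<bar> / N \<ge> 0" using N by simp
    ultimately have "\<not> \<bar>t\<bar> / N \<le> s" by linarith
    with False show ?thesis by (simp add: \<Phi>_def)
  next
    case True
    have "\<bar>t\<bar> / N \<le> s \<longleftrightarrow> t \<in> {- (N * s)..N * s}"
      using N by (auto simp: divide_simps mult.commute)
    with True show ?thesis by (simp add: \<Phi>_def)
  qed
  have hb: "has_bochner_integral lborel (\<Phi> t) (K (\<bar>t\<bar> / N) *\<^sub>R f t)" for t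
    unfolding \<Phi>1 using N by (intro has_bochner_integral_scaleR_left K) auto
  have "integrable (lborel \<Otimes>\<^sub>M lborel) (case_prod \<Phi>)"
  proof (rule lborel_pair.Fubini_integrable)
    show "case_prod \<Phi> \<in> borel_measurable (lborel \<Otimes>\<^sub>M lborel)"
      unfolding \<Phi>_def by measurable
    have "(LBINT s. norm (case (t, s) of (x, xa) \<Rightarrow> \<Phi> x xa)) = norm (K (\<bar>t\<bar> / N) *\<^sub>R f t)" for t
    proof -
      have K0: "K (\<bar>t\<bar> / N) \<ge> 0"
      proof -
        have "0 \<le> \<bar>t\<bar> / N" using N by simp
        then have "0 \<le> (LBINT s. indicator {\<bar>t\<bar> / N..} s * w s)"
          using w by (intro Bochner_Integration.integral_nonneg) (auto split: split_indicator)
        also have "\<dots> = K (\<bar>t\<bar> / N)"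
          using N by (intro has_bochner_integral_integral_eq K) simp
        finally show ?thesis .
      qed
      have "has_bochner_integral lborel (\<lambda>s. (indicator {\<bar>t\<bar> / N..} s * w s) *\<^sub>R norm (f t))
        (K (\<bar>t\<bar> / N) *\<^sub>R norm (f t))"
        using N by (intro has_bochner_integral_scaleR_left K) auto
      moreover have "(indicator {\<bar>t\<bar> / N..} s * w s) *\<^sub>R norm (f t) = norm (\<Phi> t s)" for s
      proof -
        have "\<bar>t\<bar> / N \<ge> 0" using N by simp
        then show ?thesis
          unfolding \<Phi>1 using w[of s] by (auto split: split_indicator)
      qed
      ultimately show ?thesis using K0 by (auto dest: has_bochner_integral_integral_eq)
    qed
    then show "integrable lborel (\<lambda>t. LBINT s. norm (case (t, s) of (x, xa) \<Rightarrow> \<Phi> x xa))"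
      using integrable_norm[OF int] by simp
    show "AE t in lborel. integrable lborel (\<lambda>s. case (t, s) of (x, xa) \<Rightarrow> \<Phi> x xa)"
      using hb by (auto dest: integrable.intros)
  qed
  then have "(LBINT s. LBINT t. \<Phi> t s) = (LBINT t. LBINT s. \<Phi> t s)"
    by (rule lborel_pair.Fubini_integral)
  moreover have "(LBINT s. \<Phi> t s) = K (\<bar>t\<bar> / N) *\<^sub>R f t" for t
    using hb by (rule has_bochner_integral_integral_eq)
  ultimately show ?thesis
    by (simp add: \<Phi>2 set_lebesgue_integral_def del: scaleR_scaleR)
qed

text \<open>Dominated convergence for the averages that the layer-cake formula produces. It serves both for
  \<open>F = at_top\<close> with \<open>\<delta> N = N\<close> and for \<open>F = at_right 0\<close> with \<open>\<delta> N = 1 / N\<close>.\<close>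

lemma integral_dilation_tendsto:
  fixes G :: "real \<Rightarrow> complex" and v \<delta> :: "real \<Rightarrow> real"
  assumes v: "integrable lborel v" "\<And>s. s < 0 \<Longrightarrow> v s = 0"
    and [measurable]: "G \<in> borel_measurable borel"
    and bnd: "\<And>r. r > 0 \<Longrightarrow> norm (G r) \<le> C"
    and lim: "(G \<longlongrightarrow> L) F"
    and \<delta>: "\<And>s. s > 0 \<Longrightarrow> filterlim (\<lambda>N. \<delta> N * s) F at_top" "\<And>N. N > 0 \<Longrightarrow> \<delta> N > 0"
  shows "((\<lambda>N. LBINT s. v s *\<^sub>R G (\<delta> N * s)) \<longlongrightarrow> (LBINT s. v s) *\<^sub>R L) at_top"
proof -
  have [measurable]: "v \<in> borel_measurable borel" using v(1) by auto
  have *: "AE s in lborel. s > 0 \<or> v s = 0"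
    using AE_lborel_singleton[of 0] by eventually_elim (use v(2) in force)
  have "((\<lambda>N. LBINT s. v s *\<^sub>R G (\<delta> N * s)) \<longlongrightarrow> (LBINT s. v s *\<^sub>R L)) at_top"
  proof (rule integral_dominated_convergence_at_top)
    show "integrable lborel (\<lambda>s. C * norm (v s))" using v(1) by auto
    show "AE s in lborel. ((\<lambda>N. v s *\<^sub>R G (\<delta> N * s)) \<longlongrightarrow> v s *\<^sub>R L) at_top"
      using * by eventually_elim
        (erule disjE, intro tendsto_intros filterlim_compose[OF lim \<delta>(1)], simp_all)
    show "\<forall>\<^sub>F N in at_top. AE s in lborel. norm (v s *\<^sub>R G (\<delta> N * s)) \<le> C * norm (v s)"
      using eventually_gt_at_top[of 0]
    proof eventually_elim
      case N: (elim N)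
      show ?case
        using *
      proof eventually_elim
        case (elim s)
        then show ?case
          using mult_left_mono[OF bnd[of "\<delta> N * s"] norm_ge_zero[of "v s"]] \<delta>(2)[OF N]
          by (auto simp: mult.commute)
      qed
    qed
  qed auto
  then show ?thesis using v(1) by simp
qed

lemma borel_measurable_symmetric_integral:
  fixes f :: "real \<Rightarrow> complex"
  assumes [measurable]: "f \<in> borel_measurable borel"
  shows "(\<lambda>r. LBINT t:{-r..r}. f t) \<in> borel_measurable borel"
proof -
  have "(\<lambda>r. LBINT t:{-r..r}. f t) = (\<lambda>r. LBINT t. (if -r \<le> t \<and> t \<le> r then 1 else 0 :: real) *\<^sub>R f t)"
    by (intro ext) (auto simp: set_lebesgue_integral_def indicator_def intro!: Bochner_Integration.integral_cong)
  also have "\<dots> \<in> borel_measurable borel" by measurable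
  finally show ?thesis .
qed

section \<open>Improper and Abel integrals\<close>

text \<open>An Abelian theorem: since \<open>exp(-a)\<close> is the integral of \<open>exp(-s)\<close> over \<open>[a, \<infinity>)\<close>, the regularized
  integral is an average of the symmetric partial integrals \<open>S(s / \<epsilon>)\<close> with respect to the probability
  density \<open>exp(-s)\<close>.\<close>

lemma has_improper_integral_imp_Abel_tendsto:
  fixes f :: "real \<Rightarrow> complex"
  assumes imp: "has_improper_integral f I"
    and int: "\<And>\<epsilon>. \<epsilon> > 0 \<Longrightarrow> integrable lborel (\<lambda>u. complex_of_real (exp (- \<epsilon> * \<bar>u\<bar>)) * f u)"
  shows "((\<lambda>\<epsilon>. LBINT u. complex_of_real (exp (- \<epsilon> * \<bar>u\<bar>)) * f u) \<longlongrightarrow> I) (at_right 0)"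
proof -
  define S where "S = (\<lambda>r. LBINT t:{-r..r}. f t)"
  have lim: "(S \<longlongrightarrow> I) at_top" and loc: "set_integrable lborel {-r..r} f" for r
    using imp by (auto simp: has_improper_integral_def S_def)
  have fm[measurable]: "f \<in> borel_measurable borel"
  proof -
    have [measurable]: "(\<lambda>u. complex_of_real (exp (- 1 * \<bar>u\<bar>)) * f u) \<in> borel_measurable borel"
      using borel_measurable_integrable[OF int[of 1]] by simp
    have "(\<lambda>u. complex_of_real (exp \<bar>u\<bar>) * (complex_of_real (exp (- 1 * \<bar>u\<bar>)) * f u)) \<in> borel_measurable borel"
      by measurable
    also have "(\<lambda>u. complex_of_real (exp \<bar>u\<bar>) * (complex_of_real (exp (- 1 * \<bar>u\<bar>)) * f u)) = f"
      by (auto simp: fun_eq_iff simp flip: mult.assoc of_real_mult exp_add)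
    finally show ?thesis .
  qed
  obtain R where R: "\<And>r. r \<ge> R \<Longrightarrow> dist (S r) I < 1"
    using tendstoD[OF lim, of 1] by (auto simp: eventually_at_top_linorder)
  define C where "C = max (norm I + 1) (LBINT t:{-R..R}. norm (f t))"
  have C: "norm (S r) \<le> C" for r
  proof (cases "r \<ge> R")
    case True
    have "norm (S r) \<le> norm I + 1"
      using R[OF True] norm_triangle_ineq2[of "S r" I] by (simp add: dist_norm)
    then show ?thesis by (simp add: C_def)
  next
    case False
    have "norm (S r) \<le> (LBINT t:{-r..r}. norm (f t))"
      unfolding S_def by (rule set_integral_norm_bound[OF loc])
    also have "\<dots> \<le> (LBINT t:{-R..R}. norm (f t))"
      using False loc[of r] loc[of R] unfolding set_lebesgue_integral_def set_integrable_def
      by (intro integral_mono) (auto split: split_indicator simp: set_integrable_def dest: integrable_norm)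
    finally show ?thesis by (simp add: C_def)
  qed
  have tail: "has_bochner_integral lborel (\<lambda>s. indicator {a..} s * exp (- s)) (exp (- a))" for a :: real
  proof -
    have "((\<lambda>s::real. - exp (- s)) \<longlongrightarrow> 0) at_top"
      by real_asymp
    then have "has_bochner_integral lborel (\<lambda>s. indicator {a..} s * exp (- s)) (0 - (- exp (- a)))"
      by (intro has_bochner_integral_tail) (auto intro!: derivative_eq_intros)
    then show ?thesis by simp
  qed
  have "((\<lambda>N. LBINT s. (indicator {0..} s * exp (- s)) *\<^sub>R S (N * s))
      \<longlongrightarrow> (LBINT s. indicator {0..} s * exp (- s) :: real) *\<^sub>R I) at_top"
  proof (rule integral_dilation_tendsto[OF _ _ _ C lim])
    show "integrable lborel (\<lambda>s. indicator {0..} s * exp (- s) :: real)"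
      using tail by (rule integrable.intros)
    show "S \<in> borel_measurable borel"
      unfolding S_def by (rule borel_measurable_symmetric_integral) fact
    show "filterlim (\<lambda>N. N * s) at_top at_top" if "s > 0" for s :: real
      using that by (simp add: filterlim_at_top_mult_tendsto_pos[OF tendsto_const] filterlim_ident)
  qed auto
  also have "(LBINT s. indicator {0..} s * exp (- s) :: real) = 1"
    using has_bochner_integral_integral_eq[OF tail[of 0]] by simp
  finally have main: "((\<lambda>N. LBINT s. (indicator {0..} s * exp (- s)) *\<^sub>R S (N * s)) \<longlongrightarrow> I) at_top"
    by simp
  have "(LBINT s. (indicator {0..} s * exp (- s)) *\<^sub>R S (N * s))
      = (LBINT u. complex_of_real (exp (- inverse N * \<bar>u\<bar>)) * f u)" if "N > 0" for N
    using integral_radial_kernel[of f "\<lambda>s. exp (- s)" "\<lambda>a. exp (- a)" N] tail int[of "inverse N"] that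
    by (simp add: S_def scaleR_conv_of_real divide_inverse mult.commute)
  then have "((\<lambda>N. LBINT u. complex_of_real (exp (- inverse N * \<bar>u\<bar>)) * f u) \<longlongrightarrow> I) at_top"
    using main by (elim Lim_transform_eventually)
      (auto intro: eventually_mono[OF eventually_gt_at_top[of 0]])
  then show ?thesis by (subst filterlim_at_right_to_top)
qed

lemma has_improper_integral_unique_Abel:
  assumes "has_Abel_integral f L" "has_improper_integral f I"
  shows "I = L"
proof (rule tendsto_unique)
  show "((\<lambda>\<epsilon>. LBINT u. complex_of_real (exp (- \<epsilon> * \<bar>u\<bar>)) * f u) \<longlongrightarrow> I) (at_right 0)"
    using assms by (intro has_improper_integral_imp_Abel_tendsto) (auto simp: has_Abel_integral_def)
qed (use assms in \<open>auto simp: has_Abel_integral_def\<close>)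

lemma integrable_imp_has_improper_integral:
  fixes f :: "real \<Rightarrow> complex"
  assumes f: "integrable lborel f"
  shows "has_improper_integral f (LBINT u. f u)"
  unfolding has_improper_integral_def
proof (intro conjI allI)
  show "set_integrable lborel {-R..R} f" for R
    unfolding set_integrable_def using f by (intro integrable_mult_indicator) auto
  have [measurable]: "f \<in> borel_measurable borel" using f by auto
  show "((\<lambda>R. LBINT u:{-R..R}. f u) \<longlongrightarrow> (LBINT u. f u)) at_top"
    unfolding set_lebesgue_integral_def
  proof (rule integral_dominated_convergence_at_top[where w = "\<lambda>u. norm (f u)"])
    show "AE u in lborel. ((\<lambda>R. indicator {-R..R} u *\<^sub>R f u) \<longlongrightarrow> f u) at_top"
    proof (intro AE_I2 tendsto_eventually)
      fix u
      show "\<forall>\<^sub>F R in at_top. indicator {-R..R} u *\<^sub>R f u = f u"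
        using eventually_ge_at_top[of "\<bar>u\<bar>"] by eventually_elim (simp add: abs_le_iff minus_le_iff)
    qed
  qed (use f in \<open>auto split: split_indicator\<close>)
qed

section \<open>Poisson integrals at points where the symmetric means converge\<close>

text \<open>The mean of \<open>f\<close> over the interval \<open>[-r, r]\<close>, meaningful for \<open>r > 0\<close>. Means about another point \<open>a\<close> are
  those of the translate \<open>t \<mapsto> f (a + t)\<close>.\<close>

definition symmetric_mean :: "(real \<Rightarrow> 'a::{banach, second_countable_topology}) \<Rightarrow> real \<Rightarrow> 'a" where
  "symmetric_mean f r = (1 / (2 * r)) *\<^sub>R (LBINT t:{-r..r}. f t)"

text \<open>The Poisson kernel is an approximate identity even at points where only the signed symmetric means
  of \<open>h\<close> converge: neither continuity nor the Lebesgue point property is needed.\<close>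

lemma Poisson_kernel_tendsto:
  fixes h :: "real \<Rightarrow> complex"
  assumes int: "integrable lborel h"
    and lim: "(symmetric_mean h \<longlongrightarrow> L) (at_right 0)"
  shows "((\<lambda>N. LBINT t. (N / (pi * (1 + (N * t)\<^sup>2))) *\<^sub>R h t) \<longlongrightarrow> L) at_top"
proof -
  \<comment> \<open>\<open>w\<close> is the negative derivative of \<open>1 / (1 + s\<^sup>2)\<close>; passing from integrals over \<open>[-r, r]\<close> to
    means multiplies it by \<open>2 s\<close>, and \<open>v = 2 s w(s) / \<pi>\<close> is a probability density on \<open>[0, \<infinity>)\<close>.\<close>
  define w v :: "real \<Rightarrow> real" where "w = (\<lambda>s. 2 * s / (1 + s\<^sup>2)\<^sup>2)"
    and "v = (\<lambda>s. 4 * s\<^sup>2 / (pi * (1 + s\<^sup>2)\<^sup>2))"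
  have pos: "1 + s\<^sup>2 > 0" "1 + s\<^sup>2 \<noteq> 0" for s :: real
    by (simp_all add: add_pos_nonneg) (smt (verit) zero_le_power2)
  have [measurable]: "h \<in> borel_measurable borel" "w \<in> borel_measurable borel" "v \<in> borel_measurable borel"
    using int unfolding w_def v_def by auto
  have w: "has_bochner_integral lborel (\<lambda>s. indicator {a..} s * w s) (1 / (1 + a\<^sup>2))" if "a \<ge> 0" for a
  proof -
    have "has_bochner_integral lborel (\<lambda>s. indicator {a..} s * w s) (0 - (- 1 / (1 + a\<^sup>2)))"
    proof (rule has_bochner_integral_tail)
      show "((\<lambda>s. - 1 / (1 + s\<^sup>2)) has_real_derivative w s) (at s)" for s
        using pos[of s] unfolding w_def
        by (auto intro!: derivative_eq_intros simp: power2_eq_square)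
      show "((\<lambda>s::real. - 1 / (1 + s\<^sup>2)) \<longlongrightarrow> 0) at_top" by real_asymp
    qed (use that in \<open>auto simp: w_def\<close>)
    then show ?thesis by simp
  qed
  have v: "has_bochner_integral lborel (\<lambda>s. indicator {0..} s * v s) 1"
  proof -
    define F :: "real \<Rightarrow> real" where "F = (\<lambda>s. 2 / pi * (arctan s - s / (1 + s\<^sup>2)))"
    have "has_bochner_integral lborel (\<lambda>s. indicator {0..} s * v s) (1 - F 0)"
    proof (rule has_bochner_integral_tail)
      show "(F has_real_derivative v s) (at s)" for s
      proof -
        have "(F has_real_derivative 2 / pi * (1 / (1 + s\<^sup>2) - (1 * (1 + s\<^sup>2) - s * (2 * s)) / (1 + s\<^sup>2)\<^sup>2)) (at s)"
          using pos[of s] unfolding F_def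
          by (auto intro!: derivative_eq_intros simp: power2_eq_square inverse_eq_divide)
        also have "2 / pi * (1 / (1 + s\<^sup>2) - (1 * (1 + s\<^sup>2) - s * (2 * s)) / (1 + s\<^sup>2)\<^sup>2) = v s"
        proof -
          have "1 / (1 + s\<^sup>2) = (1 + s\<^sup>2) / (1 + s\<^sup>2)\<^sup>2"
            using pos[of s] by (simp add: power2_eq_square)
          then show ?thesis
            unfolding v_def by (simp only: diff_divide_distrib[symmetric]) (simp add: power2_eq_square)
        qed
        finally show ?thesis .
      qed
      show "(F \<longlongrightarrow> 1) at_top"
      proof -
        have "((\<lambda>s. 2 / pi * (arctan s - s / (1 + s\<^sup>2))) \<longlongrightarrow> 2 / pi * (pi / 2 - 0)) at_top"
          by (intro tendsto_intros tendsto_arctan_at_top) real_asymp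
        then show ?thesis by (simp add: F_def)
      qed
    qed (auto simp: v_def)
    then show ?thesis by (simp add: F_def)
  qed
  define S where "S = (\<lambda>r. LBINT t:{-r..r}. h t)"
  have [measurable]: "S \<in> borel_measurable borel"
    unfolding S_def by (rule borel_measurable_symmetric_integral) fact
  have mean_eq: "symmetric_mean h = (\<lambda>r. (1 / (2 * r)) *\<^sub>R S r)"
    by (simp add: symmetric_mean_def S_def fun_eq_iff)
  have set_int: "set_integrable lborel A h" if "A \<in> sets borel" for A
    unfolding set_integrable_def using that int by (intro integrable_mult_indicator) auto
  obtain r0 where r0: "r0 > 0" "\<And>r. 0 < r \<Longrightarrow> r < r0 \<Longrightarrow> dist (symmetric_mean h r) L < 1"
    using tendstoD[OF lim, of 1] by (auto simp: eventually_at_right_field)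
  define C where "C = max (norm L + 1) ((LBINT t. norm (h t)) / (2 * r0))"
  have C: "norm (symmetric_mean h r) \<le> C" if "r > 0" for r
  proof (cases "r < r0")
    case True
    have "norm (symmetric_mean h r) \<le> norm L + 1"
      using r0(2)[OF that True] norm_triangle_ineq2[of "symmetric_mean h r" L] by (simp add: dist_norm)
    then show ?thesis by (simp add: C_def)
  next
    case False
    have "norm (S r) \<le> (LBINT t:{-r..r}. norm (h t))"
      unfolding S_def by (rule set_integral_norm_bound) (simp add: set_int)
    also have "\<dots> \<le> (LBINT t. norm (h t))"
      using int set_int[of "{-r..r}"] unfolding set_lebesgue_integral_def set_integrable_def
      by (intro integral_mono) (auto split: split_indicator dest: integrable_norm)
    finally have "norm (symmetric_mean h r) \<le> (LBINT t. norm (h t)) / (2 * r)"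
      using that by (simp add: mean_eq divide_simps)
    also have "\<dots> \<le> (LBINT t. norm (h t)) / (2 * r0)"
      using False r0(1) by (intro divide_left_mono) auto
    finally show ?thesis by (simp add: C_def)
  qed
  have "((\<lambda>N. LBINT s. (indicator {0..} s * v s) *\<^sub>R symmetric_mean h (1 / N * s))
      \<longlongrightarrow> (LBINT s. indicator {0..} s * v s) *\<^sub>R L) at_top"
  proof (rule integral_dilation_tendsto[OF _ _ _ C lim])
    show "integrable lborel (\<lambda>s. indicator {0..} s * v s)"
      using v by (rule integrable.intros)
    show "symmetric_mean h \<in> borel_measurable borel"
      unfolding mean_eq by measurable
    show "filterlim (\<lambda>N. 1 / N * s) (at_right 0) at_top" if "s > 0" for s :: real
      using that by real_asymp
  qed auto
  then have main: "((\<lambda>N. LBINT s. (indicator {0..} s * v s) *\<^sub>R symmetric_mean h (1 / N * s)) \<longlongrightarrow> L) at_top"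
    using has_bochner_integral_integral_eq[OF v] by simp
  have "(LBINT s. (indicator {0..} s * v s) *\<^sub>R symmetric_mean h (1 / N * s))
      = (LBINT t. (N / (pi * (1 + (N * t)\<^sup>2))) *\<^sub>R h t)" if N: "N > 0" for N
  proof -
    have "integrable lborel (\<lambda>t. (1 / (1 + (\<bar>t\<bar> / (1 / N))\<^sup>2)) *\<^sub>R h t)"
    proof (rule Bochner_Integration.integrable_bound[OF int])
      have "inverse (1 + (N * t)\<^sup>2) * norm (h t) \<le> 1 * norm (h t)" for t
        by (intro mult_right_mono) (auto simp: inverse_le_1_iff)
      then show "AE t in lborel. norm ((1 / (1 + (\<bar>t\<bar> / (1 / N))\<^sup>2)) *\<^sub>R h t) \<le> norm (h t)"
        by (simp add: power_mult_distrib abs_of_pos[OF pos(1)] divide_simps mult.commute)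
    qed measurable
    then have "(LBINT t. (1 / (1 + (\<bar>t\<bar> / (1 / N))\<^sup>2)) *\<^sub>R h t)
      = (LBINT s. (indicator {0..} s * w s) *\<^sub>R (LBINT t:{- (1 / N * s)..1 / N * s}. h t))"
      using N by (intro integral_radial_kernel w) (auto simp: w_def)
    then have "(LBINT s. (N / pi) *\<^sub>R ((indicator {0..} s * w s) *\<^sub>R S (1 / N * s)))
       = (LBINT t. (N / pi) *\<^sub>R ((1 / (1 + (\<bar>t\<bar> / (1 / N))\<^sup>2)) *\<^sub>R h t))"
      by (simp add: S_def del: scaleR_scaleR)
    also have "(\<lambda>t. (N / pi) *\<^sub>R ((1 / (1 + (\<bar>t\<bar> / (1 / N))\<^sup>2)) *\<^sub>R h t))
       = (\<lambda>t. (N / (pi * (1 + (N * t)\<^sup>2))) *\<^sub>R h t)"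
      by (simp add: power_mult_distrib fun_eq_iff mult.commute)
    also have "(\<lambda>s. (N / pi) *\<^sub>R ((indicator {0..} s * w s) *\<^sub>R S (1 / N * s)))
       = (\<lambda>s. (indicator {0..} s * v s) *\<^sub>R symmetric_mean h (1 / N * s))"
    proof
      fix s :: real
      show "(N / pi) *\<^sub>R ((indicator {0..} s * w s) *\<^sub>R S (1 / N * s))
        = (indicator {0..} s * v s) *\<^sub>R symmetric_mean h (1 / N * s)"
      \<comment> \<open>At \<open>s = 0\<close> the mean has denominator \<open>0\<close>, but both weights vanish.\<close>
      proof (cases "s = 0")
        case False
        have "N / pi * w s = v s * (1 / (2 * (1 / N * s)))"
          using False N by (simp add: w_def v_def divide_simps power2_eq_square)
        then show ?thesis by (cases "s \<ge> 0") (auto simp: mean_eq)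
      qed (simp add: w_def v_def)
    qed
    finally show ?thesis .
  qed
  then show ?thesis
    using main by (elim Lim_transform_eventually)
      (auto intro: eventually_mono[OF eventually_gt_at_top[of 0]])
qed

section \<open>Abel integrals of Fourier transforms\<close>

lemma has_bochner_integral_exp_Ici:
  fixes z :: complex
  assumes z: "Re z > 0"
  shows "has_bochner_integral lborel (\<lambda>u. indicator {0..} u *\<^sub>R exp (- z * of_real u)) (1 / z)"
proof -
  have z0: "z \<noteq> 0" using z by auto
  have int: "set_integrable lborel {0..} (\<lambda>u. exp (- z * of_real u))"
    unfolding set_integrable_def
  proof (rule Bochner_Integration.integrable_bound)
    have "has_bochner_integral lborel (\<lambda>u. indicator {0..} u * exp (- (Re z * u)))
        (0 - (- exp (- (Re z * 0)) / Re z))"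
    proof (rule has_bochner_integral_tail)
      show "((\<lambda>u. - exp (- (Re z * u)) / Re z) \<longlongrightarrow> 0) at_top"
        using z by real_asymp
    qed (use z in \<open>auto intro!: derivative_eq_intros\<close>)
    then show "integrable lborel (\<lambda>u. indicator {0..} u * exp (- (Re z * u)))"
      by (rule integrable.intros)
  qed (auto split: split_indicator)
  have "((\<lambda>b. LBINT u:{0..b}. exp (- z * of_real u)) \<longlongrightarrow> (LBINT u:{0..}. exp (- z * of_real u))) at_top"
    using int by (intro tendsto_set_lebesgue_integral_at_top) auto
  moreover have "((\<lambda>b. LBINT u:{0..b}. exp (- z * of_real u)) \<longlongrightarrow> 1 / z) at_top"
  proof (rule Lim_transform_eventually)
    have "((\<lambda>b. exp (- z * complex_of_real b)) \<longlongrightarrow> 0) at_top"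
    proof (rule tendsto_norm_zero_cancel)
      have "((\<lambda>b. exp (- (Re z * b))) \<longlongrightarrow> 0) at_top"
        using z by real_asymp
      then show "((\<lambda>b. norm (exp (- z * complex_of_real b))) \<longlongrightarrow> 0) at_top"
        by simp
    qed
    then have "((\<lambda>b. - exp (- z * complex_of_real b) / z - (- 1 / z)) \<longlongrightarrow> - 0 / z - (- 1 / z)) at_top"
      by (intro tendsto_intros z0)
    then show "((\<lambda>b. - exp (- z * complex_of_real b) / z - (- 1 / z)) \<longlongrightarrow> 1 / z) at_top"
      by simp
    show "\<forall>\<^sub>F b in at_top. - exp (- z * complex_of_real b) / z - (- 1 / z)
        = (LBINT u:{0..b}. exp (- z * of_real u))"
      using eventually_ge_at_top[of 0]
    proof eventually_elim
      case (elim b)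
      have "((\<lambda>u. - exp (- z * complex_of_real u) / z) has_vector_derivative exp (- z * of_real u)) (at u within {0..b})" for u
        using z0 by (auto intro!: derivative_eq_intros has_vector_derivative_real_field)
      then show ?case
        unfolding set_lebesgue_integral_def
        using elim by (subst integral_FTC_atLeastAtMost[where F = "\<lambda>u. - exp (- z * complex_of_real u) / z"])
          (auto intro!: continuous_intros)
    qed
  qed
  ultimately have "(LBINT u:{0..}. exp (- z * of_real u)) = 1 / z"
    using tendsto_unique trivial_limit_at_top_linorder by blast
  then show ?thesis
    using int by (simp add: has_bochner_integral_iff set_integrable_def set_lebesgue_integral_def)
qed

lemma has_bochner_integral_exp_abs_Fourier:
  fixes \<epsilon> b :: real
  assumes "\<epsilon> > 0"
  shows "has_bochner_integral lborel
    (\<lambda>u. complex_of_real (exp (- \<epsilon> * \<bar>u\<bar>)) * exp (- \<i> * complex_of_real (b * u)))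
    (complex_of_real (2 * \<epsilon> / (\<epsilon>\<^sup>2 + b\<^sup>2)))"
proof -
  define z where "z = Complex \<epsilon> b"
  let ?g = "\<lambda>z u. indicator {0..} u *\<^sub>R exp (- z * complex_of_real u)"
  have z: "z = \<epsilon> + \<i> * b" by (simp add: z_def complex_eq_iff)
  have 1: "has_bochner_integral lborel (?g z) (1 / z)"
    using assms by (intro has_bochner_integral_exp_Ici) (simp add: z_def)
  have "has_bochner_integral lborel (?g (cnj z)) (1 / cnj z)"
    using assms by (intro has_bochner_integral_exp_Ici) (simp add: z_def)
  then have 2: "has_bochner_integral lborel (\<lambda>u. ?g (cnj z) (0 + (-1) * u)) (1 / cnj z)"
    using lborel_has_bochner_integral_real_affine_iff[of "-1" "?g (cnj z)" "1 / cnj z" 0] by simp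
  have "has_bochner_integral lborel (\<lambda>u. ?g z u + ?g (cnj z) (0 + (-1) * u)) (1 / z + 1 / cnj z)"
    by (rule has_bochner_integral_add[OF 1 2])
  also have "1 / z + 1 / cnj z = complex_of_real (2 * \<epsilon> / (\<epsilon>\<^sup>2 + b\<^sup>2))"
  proof -
    have "z \<noteq> 0" using assms by (auto simp: z_def complex_eq_iff)
    then have "1 / z + 1 / cnj z = (z + cnj z) / (z * cnj z)"
      by (simp add: field_simps)
    also have "\<dots> = complex_of_real (2 * \<epsilon> / (\<epsilon>\<^sup>2 + b\<^sup>2))"
      by (simp add: complex_add_cnj complex_mult_cnj z_def)
    finally show ?thesis .
  qed
  finally have 3: "has_bochner_integral lborel (\<lambda>u. ?g z u + ?g (cnj z) (0 + (-1) * u))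
    (complex_of_real (2 * \<epsilon> / (\<epsilon>\<^sup>2 + b\<^sup>2)))" .
  show ?thesis
  proof (rule has_bochner_integral_cong_AE[THEN iffD1, OF _ _ _ 3])
    show "AE u in lborel. ?g z u + ?g (cnj z) (0 + (-1) * u)
      = complex_of_real (exp (- \<epsilon> * \<bar>u\<bar>)) * exp (- \<i> * complex_of_real (b * u))"
      using AE_lborel_singleton[of 0]
      by eventually_elim
        (auto simp: z exp_of_real[symmetric] exp_add[symmetric] algebra_simps split: split_indicator)
  qed auto
qed

text \<open>Abel-regularized Fourier inversion at the origin: the regularized integral is the Poisson integral
  of \<open>h\<close> with parameter \<open>N = \<bar>c\<bar> / \<epsilon>\<close>.\<close>

lemma Fourier_has_Abel_integral:
  fixes h :: "real \<Rightarrow> complex" and c :: real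
  assumes h: "integrable lborel h" and c: "c \<noteq> 0"
    and mean: "(symmetric_mean h \<longlongrightarrow> L) (at_right 0)"
  shows "has_Abel_integral (\<lambda>u. complex_of_real (\<bar>c\<bar> / (2 * pi)) *
     (LBINT t. h t * exp (- \<i> * complex_of_real (c * t * u)))) L"
    (is "has_Abel_integral ?F L")
proof -
  define E where "E = (\<lambda>\<epsilon> t u. complex_of_real (exp (- \<epsilon> * \<bar>u\<bar>)) * (h t * exp (- \<i> * complex_of_real (c * t * u))))"
  have [measurable]: "h \<in> borel_measurable borel" using h by auto
  have E: "has_bochner_integral lborel (E \<epsilon> t) (h t * complex_of_real (2 * \<epsilon> / (\<epsilon>\<^sup>2 + (c * t)\<^sup>2)))"
    if "\<epsilon> > 0" for \<epsilon> t
    using has_bochner_integral_mult_right[OF has_bochner_integral_exp_abs_Fourier[OF that, of "c * t"], of "h t"]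
    by (simp add: E_def mult_ac)
  have pair: "integrable (lborel \<Otimes>\<^sub>M lborel) (case_prod (E \<epsilon>))" if "\<epsilon> > 0" for \<epsilon>
  proof (rule lborel_pair.Fubini_integrable)
    show "case_prod (E \<epsilon>) \<in> borel_measurable (lborel \<Otimes>\<^sub>M lborel)"
      unfolding E_def by measurable
    have "(LBINT u. norm (E \<epsilon> t u)) = norm (h t) * (LBINT u. exp (- \<epsilon> * \<bar>u\<bar>))" for t
      by (simp add: E_def norm_mult mult.commute)
    then show "integrable lborel (\<lambda>t. LBINT u. norm (case (t, u) of (x, xa) \<Rightarrow> E \<epsilon> x xa))"
      using h by simp
    show "AE t in lborel. integrable lborel (\<lambda>u. case (t, u) of (x, xa) \<Rightarrow> E \<epsilon> x xa)"
      using E[OF that] by (auto intro: integrable.intros)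
  qed
  have F: "complex_of_real (exp (- \<epsilon> * \<bar>u\<bar>)) * ?F u = complex_of_real (\<bar>c\<bar> / (2 * pi)) * (LBINT t. E \<epsilon> t u)" for \<epsilon> u
    unfolding E_def integral_mult_right_zero by (rule mult.left_commute)
  have val: "(LBINT u. complex_of_real (exp (- \<epsilon> * \<bar>u\<bar>)) * ?F u)
     = (LBINT t. (\<bar>c\<bar> / \<epsilon> / (pi * (1 + (\<bar>c\<bar> / \<epsilon> * t)\<^sup>2))) *\<^sub>R h t)" if "\<epsilon> > 0" for \<epsilon>
  proof -
    have "(LBINT u. complex_of_real (exp (- \<epsilon> * \<bar>u\<bar>)) * ?F u)
      = complex_of_real (\<bar>c\<bar> / (2 * pi)) * (LBINT u. LBINT t. E \<epsilon> t u)"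
      unfolding F by (rule integral_mult_right_zero)
    also have "\<dots> = complex_of_real (\<bar>c\<bar> / (2 * pi)) * (LBINT t. LBINT u. E \<epsilon> t u)"
      by (subst lborel_pair.Fubini_integral[OF pair[OF that]]) simp
    also have "\<dots> = (LBINT t. complex_of_real (\<bar>c\<bar> / (2 * pi)) *
        (h t * complex_of_real (2 * \<epsilon> / (\<epsilon>\<^sup>2 + (c * t)\<^sup>2))))"
      by (simp only: has_bochner_integral_integral_eq[OF E[OF that]] integral_mult_right_zero)
    also have "\<dots> = (LBINT t. (\<bar>c\<bar> / \<epsilon> / (pi * (1 + (\<bar>c\<bar> / \<epsilon> * t)\<^sup>2))) *\<^sub>R h t)"
    proof (rule Bochner_Integration.integral_cong[OF refl])
      fix t :: real
      have p: "\<epsilon>\<^sup>2 + (c * t)\<^sup>2 > 0" using that by (simp add: add_pos_nonneg)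
      have "\<bar>c\<bar> / \<epsilon> / (pi * (1 + (\<bar>c\<bar> / \<epsilon> * t)\<^sup>2)) = \<bar>c\<bar> / \<epsilon> / (pi * ((\<epsilon>\<^sup>2 + (c * t)\<^sup>2) / \<epsilon>\<^sup>2))"
        using that by (simp add: power_mult_distrib power_divide add_divide_distrib)
      also have "\<dots> = \<bar>c\<bar> / (2 * pi) * (2 * \<epsilon> / (\<epsilon>\<^sup>2 + (c * t)\<^sup>2))"
        using that p by (simp add: power2_eq_square)
      finally show "complex_of_real (\<bar>c\<bar> / (2 * pi)) * (h t * complex_of_real (2 * \<epsilon> / (\<epsilon>\<^sup>2 + (c * t)\<^sup>2)))
          = (\<bar>c\<bar> / \<epsilon> / (pi * (1 + (\<bar>c\<bar> / \<epsilon> * t)\<^sup>2))) *\<^sub>R h t"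
        by (simp only: scaleR_conv_of_real of_real_mult mult_ac)
    qed
    finally show ?thesis .
  qed
  show ?thesis
    unfolding has_Abel_integral_def
  proof (intro conjI allI impI)
    show "integrable lborel (\<lambda>u. complex_of_real (exp (- \<epsilon> * \<bar>u\<bar>)) * ?F u)" if "\<epsilon> > 0" for \<epsilon>
      unfolding F by (intro integrable_mult_right lborel_pair.integrable_snd[OF pair[OF that]])
    have "filterlim (\<lambda>\<epsilon>. \<bar>c\<bar> / \<epsilon>) at_top (at_right 0)"
      using c by real_asymp
    from filterlim_compose[OF Poisson_kernel_tendsto[OF h mean] this]
    show "((\<lambda>\<epsilon>. LBINT u. complex_of_real (exp (- \<epsilon> * \<bar>u\<bar>)) * ?F u) \<longlongrightarrow> L) (at_right 0)"
    proof (rule Lim_transform_eventually)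
      show "\<forall>\<^sub>F \<epsilon> in at_right 0. (LBINT t. (\<bar>c\<bar> / \<epsilon> / (pi * (1 + (\<bar>c\<bar> / \<epsilon> * t)\<^sup>2))) *\<^sub>R h t)
          = (LBINT u. complex_of_real (exp (- \<epsilon> * \<bar>u\<bar>)) * ?F u)"
        using eventually_at_right_less[of 0] by eventually_elim (simp only: val)
    qed
  qed
qed

section \<open>Differentiation of integrals by symmetric means\<close>

lemma AE_one_sided_mean:
  fixes f :: "real \<Rightarrow> 'a::euclidean_space"
  assumes loc: "\<And>a b. set_integrable lborel {a..b} f"
  shows "AE a in lborel. ((\<lambda>r. (1 / r) *\<^sub>R (LBINT t:{a..a+r}. f t)) \<longlongrightarrow> f a) (at_right 0)"
proof -
  have "f integrable_on cbox a b" for a b :: real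
    using set_borel_integral_eq_integral(1)[OF loc] by simp
  then obtain N where N: "negligible N"
    "\<And>x e. \<lbrakk>x \<notin> N; 0 < e\<rbrakk> \<Longrightarrow> \<exists>d>0. \<forall>h. 0 < h \<and> h < d \<longrightarrow>
       norm (integral (cbox x (x + h *\<^sub>R One)) f /\<^sub>R h ^ DIM(real) - f x) < e"
    by (rule integrable_ccontinuous_explicit) blast
  have "AE a in lebesgue. a \<notin> N"
    using N(1) by (intro AE_not_in) (simp add: negligible_iff_null_sets)
  then have "AE a in lborel. a \<notin> N"
    by (simp add: AE_completion_iff)
  then show ?thesis
  proof eventually_elim
    case (elim a)
    show ?case
    proof (rule tendstoI)
      fix e :: real assume "e > 0"
      then obtain d where "d > 0" and d: "\<And>h. 0 < h \<Longrightarrow> h < d \<Longrightarrow>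
         norm (integral (cbox a (a + h *\<^sub>R One)) f /\<^sub>R h ^ DIM(real) - f a) < e"
        using N(2)[OF elim] by blast
      have "dist ((1 / r) *\<^sub>R (LBINT t:{a..a+r}. f t)) (f a) < e" if "0 < r" "r < d" for r
        using d[OF that] set_borel_integral_eq_integral(2)[OF loc[of a "a + r"]]
        by (simp add: dist_norm inverse_eq_divide)
      then show "\<forall>\<^sub>F r in at_right 0. dist ((1 / r) *\<^sub>R (LBINT t:{a..a+r}. f t)) (f a) < e"
        using \<open>d > 0\<close> by (auto simp: eventually_at_right_field)
    qed
  qed
qed

text \<open>Unlike \<open>AE_borel_affine\<close>, this does not require \<open>P\<close> to be measurable.\<close>

lemma AE_lborel_affine:
  assumes "AE a in lborel. P a" "c \<noteq> 0"
  shows "AE a in lborel. P (t + c * a :: real)"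
proof -
  obtain N where N: "{a \<in> space lborel. \<not> P a} \<subseteq> N" "N \<in> null_sets lborel"
    using AE_E[OF assms(1)] by (metis null_setsI)
  then have [measurable]: "N \<in> sets borel" by auto
  have "AE a in lborel. a \<notin> N" using N(2) by (rule AE_not_in)
  then have "AE a in lborel. t + c * a \<notin> N"
    by (intro AE_borel_affine[OF assms(2)]) measurable
  then show ?thesis
    by eventually_elim (use N(1) in auto)
qed

text \<open>Lebesgue's differentiation theorem for symmetric intervals: the left half follows from the right half
  applied to the reflected function.\<close>

theorem AE_symmetric_mean_tendsto:
  fixes f :: "real \<Rightarrow> 'a::euclidean_space"
  assumes loc: "\<And>a b. set_integrable lborel {a..b} f"
  shows "AE a in lborel. (symmetric_mean (\<lambda>t. f (a + t)) \<longlongrightarrow> f a) (at_right 0)"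
proof -
  have reflect: "set_integrable lborel {a..b} (\<lambda>t. f (- t)) \<and>
      (LBINT t:{a..b}. f (- t)) = (LBINT t:{-b..-a}. f t)" for a b
  proof -
    let ?g = "\<lambda>t. indicator {-b..-a} t *\<^sub>R f t"
    have eq: "(\<lambda>t. ?g (0 + (-1) * t)) = (\<lambda>t. indicator {a..b} t *\<^sub>R f (- t))"
      by (auto simp: fun_eq_iff split: split_indicator)
    have "integrable lborel ?g" using loc[of "-b" "-a"] by (simp add: set_integrable_def)
    from lborel_integrable_real_affine[OF this, of "-1" 0]
    have "set_integrable lborel {a..b} (\<lambda>t. f (- t))"
      unfolding set_integrable_def eq[symmetric] by simp
    moreover have "(LBINT t. ?g t) = (LBINT t. ?g (0 + (-1) * t))"
      by (subst lborel_integral_real_affine[of "-1" _ 0]) auto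
    ultimately show ?thesis unfolding eq by (simp add: set_lebesgue_integral_def)
  qed
  have shift: "(LBINT t:{-r..r}. f (a + t)) = (LBINT t:{a-r..a+r}. f t)" for a r
    unfolding set_lebesgue_integral_def
    by (subst lborel_integral_real_affine[of 1 _ a])
      (auto intro!: Bochner_Integration.integral_cong split: split_indicator)
  have split: "(LBINT t:{a-r..a+r}. f t) = (LBINT t:{a-r..a}. f t) + (LBINT t:{a..a+r}. f t)"
    if "r > 0" for a r
  proof -
    have "{a-r..a+r} = {a-r..a} \<union> {a..a+r}" using that by auto
    moreover have "AE t in lborel. \<not> (t \<in> {a-r..a} \<and> t \<in> {a..a+r})"
      using AE_lborel_singleton[of a] by eventually_elim auto
    ultimately show ?thesis
      using set_integral_Un_AE[of "{a-r..a}" "{a..a+r}" lborel f] loc by simp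
  qed
  have "AE a in lborel. ((\<lambda>r. (1 / r) *\<^sub>R (LBINT t:{a..a+r}. f (- t))) \<longlongrightarrow> f (- a)) (at_right 0)"
    using reflect by (intro AE_one_sided_mean) auto
  from AE_lborel_affine[OF this, of "-1" 0]
  have left: "AE a in lborel. ((\<lambda>r. (1 / r) *\<^sub>R (LBINT t:{a-r..a}. f t)) \<longlongrightarrow> f a) (at_right 0)"
    using reflect by simp
  show ?thesis
    using AE_one_sided_mean[OF loc] left
  proof eventually_elim
    case (elim a)
    have "((\<lambda>r. (1/2) *\<^sub>R ((1 / r) *\<^sub>R (LBINT t:{a-r..a}. f t) + (1 / r) *\<^sub>R (LBINT t:{a..a+r}. f t)))
        \<longlongrightarrow> (1/2) *\<^sub>R (f a + f a)) (at_right 0)"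
      by (intro tendsto_intros elim)
    also have "(1/2) *\<^sub>R (f a + f a) = f a"
      by (simp add: scaleR_2[symmetric])
    finally show ?case
    proof (rule Lim_transform_eventually)
      show "\<forall>\<^sub>F r in at_right 0. (1/2) *\<^sub>R ((1 / r) *\<^sub>R (LBINT t:{a-r..a}. f t) + (1 / r) *\<^sub>R (LBINT t:{a..a+r}. f t))
          = symmetric_mean (\<lambda>t. f (a + t)) r"
        using eventually_at_right_less[of 0]
        by eventually_elim (simp add: symmetric_mean_def shift split scaleR_add_right)
    qed
  qed
qed

lemma symmetric_mean_const:
  "r > 0 \<Longrightarrow> symmetric_mean (\<lambda>t. c) r = c"
  by (simp add: symmetric_mean_def set_lebesgue_integral_def)

lemma symmetric_mean_add:
  "set_integrable lborel {-r..r} f \<Longrightarrow> set_integrable lborel {-r..r} g \<Longrightarrow>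
   symmetric_mean (\<lambda>t. f t + g t) r = symmetric_mean f r + symmetric_mean g r"
  by (simp add: symmetric_mean_def set_integral_add scaleR_add_right)

lemma symmetric_mean_linear:
  assumes "bounded_linear T" "set_integrable lborel {-r..r} f"
  shows "symmetric_mean (\<lambda>t. T (f t)) r = T (symmetric_mean f r)"
proof -
  interpret bounded_linear T by fact
  have "(\<lambda>t. indicator {-r..r} t *\<^sub>R T (f t)) = (\<lambda>t. T (indicator {-r..r} t *\<^sub>R f t))"
    by (simp add: scaleR fun_eq_iff)
  then show ?thesis
    using integral_bounded_linear[OF assms(1), of lborel "\<lambda>t. indicator {-r..r} t *\<^sub>R f t"] assms(2)
    by (simp add: symmetric_mean_def set_lebesgue_integral_def set_integrable_def scaleR)
qed

lemma set_integrable_linear: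
  assumes "bounded_linear T" "set_integrable M A f"
  shows "set_integrable M A (\<lambda>t. T (f t))"
proof -
  interpret bounded_linear T by fact
  have "(\<lambda>t. indicator A t *\<^sub>R T (f t)) = (\<lambda>t. T (indicator A t *\<^sub>R f t))"
    by (simp add: scaleR fun_eq_iff)
  then show ?thesis
    using integrable_bounded_linear[OF assms(1)] assms(2) by (simp add: set_integrable_def)
qed

text \<open>A point where the symmetric means of \<open>y\<close> and of \<open>\<bar>y\<bar>\<^sup>2\<close> both converge to the values of these
  functions. Together these two scalar conditions imply the quadratic Lebesgue point property
  (\<open>L2_mean_point_deviation\<close>).\<close>

definition L2_mean_point :: "(real \<Rightarrow> complex) \<Rightarrow> real \<Rightarrow> bool" where
  "L2_mean_point y a \<longleftrightarrow>
     (symmetric_mean (\<lambda>t. y (a + t)) \<longlongrightarrow> y a) (at_right 0) \<and>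
     (symmetric_mean (\<lambda>t. (cmod (y (a + t)))\<^sup>2) \<longlongrightarrow> (cmod (y a))\<^sup>2) (at_right 0)"

lemma set_integrable_Icc_of_square:
  fixes y :: "real \<Rightarrow> complex"
  assumes [measurable]: "y \<in> borel_measurable borel" and int: "integrable lborel (\<lambda>t. (cmod (y t))\<^sup>2)"
  shows "set_integrable lborel {a..b} y"
proof (rule set_integrable_bound)
  show "set_integrable lborel {a..b} (\<lambda>t. 1 + (cmod (y t))\<^sup>2)"
  proof (rule set_integral_add)
    show "set_integrable lborel {a..b} (\<lambda>t. 1 :: real)"
      by (rule borel_integrable_atLeastAtMost') auto
    show "set_integrable lborel {a..b} (\<lambda>t. (cmod (y t))\<^sup>2)"
      unfolding set_integrable_def using int by (intro integrable_mult_indicator) auto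
  qed
  have "cmod (y t) \<le> norm (1 + (cmod (y t))\<^sup>2)" for t
  proof -
    have "0 \<le> (cmod (y t) - 1)\<^sup>2 + (cmod (y t))\<^sup>2 + 1" by simp
    then show ?thesis by (simp add: power2_diff)
  qed
  then show "AE t in lborel. t \<in> {a..b} \<longrightarrow> norm (y t) \<le> norm (1 + (cmod (y t))\<^sup>2)"
    by simp
qed (simp_all add: set_borel_measurable_def)

lemma AE_L2_mean_point:
  assumes "y \<in> borel_measurable borel" and int: "integrable lborel (\<lambda>t. (cmod (y t))\<^sup>2)"
  shows "AE a in lborel. L2_mean_point y a"
proof -
  have "set_integrable lborel {a..b} (\<lambda>t. (cmod (y t))\<^sup>2)" for a b
    unfolding set_integrable_def using int by (intro integrable_mult_indicator) auto
  from AE_symmetric_mean_tendsto[OF this]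
    AE_symmetric_mean_tendsto[OF set_integrable_Icc_of_square[OF assms]]
  show ?thesis
    by eventually_elim (simp add: L2_mean_point_def)
qed

lemma integrable_square_shift:
  fixes y :: "real \<Rightarrow> complex"
  assumes "integrable lborel (\<lambda>t. (cmod (y t))\<^sup>2)"
  shows "integrable lborel (\<lambda>t. (cmod (y (a + t)))\<^sup>2)"
  using lborel_integrable_real_affine[OF assms, of 1 a] by simp

text \<open>Expand \<open>\<bar>y(a + t) - y(a)\<bar>\<^sup>2 = \<bar>y(a + t)\<bar>\<^sup>2 - 2 Re (y(a + t) cnj (y a)) + \<bar>y a\<bar>\<^sup>2\<close> and take means; the
  limits \<open>\<bar>y a\<bar>\<^sup>2 - 2 \<bar>y a\<bar>\<^sup>2 + \<bar>y a\<bar>\<^sup>2\<close> cancel.\<close>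

lemma L2_mean_point_deviation:
  fixes y :: "real \<Rightarrow> complex"
  assumes m: "y \<in> borel_measurable borel" and int: "integrable lborel (\<lambda>t. (cmod (y t))\<^sup>2)"
    and a: "L2_mean_point y a"
  shows "(symmetric_mean (\<lambda>t. (cmod (y (a + t) - y a))\<^sup>2) \<longlongrightarrow> 0) (at_right 0)"
proof -
  have [measurable]: "y \<in> borel_measurable borel" by fact
  have int': "integrable lborel (\<lambda>t. (cmod (y (a + t)))\<^sup>2)" by (rule integrable_square_shift[OF int])
  have 1: "set_integrable lborel {-r..r} (\<lambda>t. y (a + t))" for r
    by (rule set_integrable_Icc_of_square[OF _ int']) measurable
  have 2: "set_integrable lborel {-r..r} (\<lambda>t. (cmod (y (a + t)))\<^sup>2)" for r
    unfolding set_integrable_def using int' by (intro integrable_mult_indicator) auto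
  define T where "T = (\<lambda>z. - 2 * Re (z * cnj (y a)))"
  have T: "bounded_linear T"
    unfolding T_def
    by (intro bounded_linear_const_mult bounded_linear_compose[OF bounded_linear_Re] bounded_linear_mult_left)
  have 3: "set_integrable lborel {-r..r} (\<lambda>t. c :: real)" for c r :: real
    by (rule borel_integrable_atLeastAtMost') auto
  have eq: "(cmod (y (a + t) - y a))\<^sup>2 = (cmod (y (a + t)))\<^sup>2 + (T (y (a + t)) + (cmod (y a))\<^sup>2)" for t
    unfolding T_def cmod_power2 by (simp add: power2_diff algebra_simps)
  have "((\<lambda>r. symmetric_mean (\<lambda>t. (cmod (y (a + t)))\<^sup>2) r
      + (T (symmetric_mean (\<lambda>t. y (a + t)) r) + (cmod (y a))\<^sup>2))
      \<longlongrightarrow> (cmod (y a))\<^sup>2 + (T (y a) + (cmod (y a))\<^sup>2)) (at_right 0)"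
    using a by (intro tendsto_intros bounded_linear.tendsto[OF T]) (simp_all add: L2_mean_point_def)
  also have "(cmod (y a))\<^sup>2 + (T (y a) + (cmod (y a))\<^sup>2) = 0"
    unfolding T_def cmod_power2 by (simp add: power2_eq_square)
  finally show ?thesis
  proof (rule Lim_transform_eventually)
    show "\<forall>\<^sub>F r in at_right 0. symmetric_mean (\<lambda>t. (cmod (y (a + t)))\<^sup>2) r
      + (T (symmetric_mean (\<lambda>t. y (a + t)) r) + (cmod (y a))\<^sup>2)
      = symmetric_mean (\<lambda>t. (cmod (y (a + t) - y a))\<^sup>2) r"
      using eventually_at_right_less[of 0]
    proof eventually_elim
      case (elim r)
      show ?case
        unfolding eq
        by (subst symmetric_mean_add[OF 2 set_integral_add(1)[OF set_integrable_linear[OF T 1] 3]])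
          (simp add: symmetric_mean_add[OF set_integrable_linear[OF T 1] 3]
            symmetric_mean_linear[OF T 1] symmetric_mean_const[OF elim])
    qed
  qed
qed

lemma set_integrable_square_deviation:
  fixes y :: "real \<Rightarrow> complex"
  assumes [measurable]: "y \<in> borel_measurable borel" and int: "integrable lborel (\<lambda>t. (cmod (y t))\<^sup>2)"
  shows "set_integrable lborel {-r..r} (\<lambda>t. (cmod (y t - c))\<^sup>2)"
proof (rule set_integrable_bound)
  show "set_integrable lborel {-r..r} (\<lambda>t. 2 * (cmod (y t))\<^sup>2 + 2 * (cmod c)\<^sup>2)"
  proof (rule set_integral_add)
    show "set_integrable lborel {-r..r} (\<lambda>t. 2 * (cmod c)\<^sup>2)"
      by (rule borel_integrable_atLeastAtMost') auto
    show "set_integrable lborel {-r..r} (\<lambda>t. 2 * (cmod (y t))\<^sup>2)"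
      unfolding set_integrable_def using int by (intro integrable_mult_indicator) auto
  qed
  have "(cmod (y t - c))\<^sup>2 \<le> 2 * (cmod (y t))\<^sup>2 + 2 * (cmod c)\<^sup>2" for t
  proof -
    have "(cmod (y t - c))\<^sup>2 \<le> (cmod (y t) + cmod c)\<^sup>2"
      by (intro power_mono norm_triangle_ineq4) auto
    also have "\<dots> \<le> 2 * (cmod (y t))\<^sup>2 + 2 * (cmod c)\<^sup>2"
      using zero_le_power2[of "cmod (y t) - cmod c"] by (simp add: power2_sum power2_diff)
    finally show ?thesis .
  qed
  then show "AE t in lborel. t \<in> {-r..r} \<longrightarrow>
      norm ((cmod (y t - c))\<^sup>2) \<le> norm (2 * (cmod (y t))\<^sup>2 + 2 * (cmod c)\<^sup>2)"
    by simp
qed (simp_all add: set_borel_measurable_def)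

lemma cmod_mult_cnj_le:
  "cmod (z * cnj w) \<le> (1/2) * ((cmod z)\<^sup>2 + (cmod w)\<^sup>2)"
  using zero_le_power2[of "cmod z - cmod w"] by (simp add: norm_mult power2_diff)

lemma borel_measurable_cnj [measurable (raw)]:
  "f \<in> borel_measurable M \<Longrightarrow> (\<lambda>t. cnj (f t)) \<in> borel_measurable M"
  by (rule borel_measurable_continuous_on[where f = cnj]) (auto intro: continuous_intros)

lemma integrable_mult_cnj:
  fixes p q :: "real \<Rightarrow> complex"
  assumes [measurable]: "p \<in> borel_measurable borel" "q \<in> borel_measurable borel"
    and "integrable lborel (\<lambda>t. (cmod (p t))\<^sup>2)" "integrable lborel (\<lambda>t. (cmod (q t))\<^sup>2)"
  shows "integrable lborel (\<lambda>t. p t * cnj (q t))"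
proof (rule Bochner_Integration.integrable_bound)
  show "integrable lborel (\<lambda>t. (1/2) * ((cmod (p t))\<^sup>2 + (cmod (q t))\<^sup>2))"
    using assms by auto
  show "AE t in lborel. norm (p t * cnj (q t)) \<le> norm ((1/2) * ((cmod (p t))\<^sup>2 + (cmod (q t))\<^sup>2))"
    using cmod_mult_cnj_le by (auto intro!: AE_I2 order_trans[OF _ abs_ge_self])
qed measurable

text \<open>Write \<open>p cnj q = D + p cnj q0 + p0 cnj q - p0 cnj q0\<close> with the product of deviations
  \<open>D = (p - p0) cnj (q - q0)\<close>. The mean of \<open>D\<close> is controlled by the quadratic deviations of the two
  factors, and the other terms are affine in the means of \<open>p\<close> and \<open>q\<close>.\<close>

lemma symmetric_mean_product_tendsto:
  fixes y :: "real \<Rightarrow> complex"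
  assumes m: "y \<in> borel_measurable borel" and int: "integrable lborel (\<lambda>t. (cmod (y t))\<^sup>2)"
    and a: "L2_mean_point y a" and b: "L2_mean_point y b"
  shows "(symmetric_mean (\<lambda>t. y (a + t) * cnj (y (b + t))) \<longlongrightarrow> y a * cnj (y b)) (at_right 0)"
proof -
  have [measurable]: "y \<in> borel_measurable borel" by fact
  define p q where "p = (\<lambda>t. y (a + t))" and "q = (\<lambda>t. y (b + t))"
  define p0 q0 where "p0 = y a" and "q0 = y b"
  define D where "D = (\<lambda>t. (p t - p0) * cnj (q t - q0))"
  have [measurable]: "p \<in> borel_measurable borel" "q \<in> borel_measurable borel"
    unfolding p_def q_def by auto
  have ip: "integrable lborel (\<lambda>t. (cmod (p t))\<^sup>2)" and iq: "integrable lborel (\<lambda>t. (cmod (q t))\<^sup>2)"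
    unfolding p_def q_def by (auto intro: integrable_square_shift int)
  have P: "set_integrable lborel {-r..r} p" and Q: "set_integrable lborel {-r..r} q" for r
    by (auto intro!: set_integrable_Icc_of_square ip iq)
  have dP: "set_integrable lborel {-r..r} (\<lambda>t. (cmod (p t - p0))\<^sup>2)"
    and dQ: "set_integrable lborel {-r..r} (\<lambda>t. (cmod (q t - q0))\<^sup>2)" for r
    by (auto intro!: set_integrable_square_deviation ip iq)
  have C: "set_integrable lborel {-r..r} (\<lambda>t. c :: complex)" for c and r :: real
    by (rule borel_integrable_atLeastAtMost') auto
  define T U where "T = (\<lambda>z. z * cnj q0)" and "U = (\<lambda>z. p0 * cnj z)"
  have T: "bounded_linear T" and U: "bounded_linear U"
    unfolding T_def U_def
    by (intro bounded_linear_mult_left bounded_linear_const_mult bounded_linear_cnj)+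
  have iD: "set_integrable lborel {-r..r} D" for r
  proof (rule set_integrable_bound[OF set_integral_add(1)[OF dP dQ]])
    show "AE t in lborel. t \<in> {-r..r} \<longrightarrow> norm (D t) \<le> norm ((cmod (p t - p0))\<^sup>2 + (cmod (q t - q0))\<^sup>2)"
    proof (intro AE_I2 impI)
      fix t
      have "norm (D t) \<le> (1/2) * ((cmod (p t - p0))\<^sup>2 + (cmod (q t - q0))\<^sup>2)"
        unfolding D_def by (rule cmod_mult_cnj_le)
      also have "\<dots> \<le> (cmod (p t - p0))\<^sup>2 + (cmod (q t - q0))\<^sup>2"
        by simp
      finally show "norm (D t) \<le> norm ((cmod (p t - p0))\<^sup>2 + (cmod (q t - q0))\<^sup>2)"
        by simp
    qed
  qed (simp_all add: set_borel_measurable_def D_def)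
  have limP: "(symmetric_mean (\<lambda>t. (cmod (p t - p0))\<^sup>2) \<longlongrightarrow> 0) (at_right 0)"
    and limQ: "(symmetric_mean (\<lambda>t. (cmod (q t - q0))\<^sup>2) \<longlongrightarrow> 0) (at_right 0)"
    unfolding p_def q_def p0_def q0_def
    using L2_mean_point_deviation[OF m int a] L2_mean_point_deviation[OF m int b] by auto
  have limD: "(symmetric_mean D \<longlongrightarrow> 0) (at_right 0)"
  proof (rule Lim_null_comparison)
    show "((\<lambda>r. (1/2) * (symmetric_mean (\<lambda>t. (cmod (p t - p0))\<^sup>2) r
        + symmetric_mean (\<lambda>t. (cmod (q t - q0))\<^sup>2) r)) \<longlongrightarrow> 0) (at_right 0)"
      using tendsto_mult[OF tendsto_const[of "1/2 :: real"] tendsto_add[OF limP limQ]] by simp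
    show "\<forall>\<^sub>F r in at_right 0. norm (symmetric_mean D r) \<le> (1/2) *
        (symmetric_mean (\<lambda>t. (cmod (p t - p0))\<^sup>2) r + symmetric_mean (\<lambda>t. (cmod (q t - q0))\<^sup>2) r)"
      using eventually_at_right_less[of 0]
    proof eventually_elim
      case (elim r)
      have "norm (LBINT t:{-r..r}. D t) \<le> (LBINT t:{-r..r}. norm (D t))"
        by (rule set_integral_norm_bound[OF iD])
      also have "\<dots> \<le> (LBINT t:{-r..r}. (1/2) * ((cmod (p t - p0))\<^sup>2 + (cmod (q t - q0))\<^sup>2))"
      proof (rule set_integral_mono)
        show "set_integrable lborel {-r..r} (\<lambda>t. norm (D t))"
          by (rule set_integrable_norm[OF iD])
        show "set_integrable lborel {-r..r} (\<lambda>t. (1/2) * ((cmod (p t - p0))\<^sup>2 + (cmod (q t - q0))\<^sup>2))"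
          by (rule set_integrable_mult_right) (rule set_integral_add(1)[OF dP dQ])
        show "norm (D t) \<le> (1/2) * ((cmod (p t - p0))\<^sup>2 + (cmod (q t - q0))\<^sup>2)" for t
          unfolding D_def by (rule cmod_mult_cnj_le)
      qed
      also have "\<dots> = (1/2) * ((LBINT t:{-r..r}. (cmod (p t - p0))\<^sup>2) + (LBINT t:{-r..r}. (cmod (q t - q0))\<^sup>2))"
        by (simp add: set_integral_add(2)[OF dP dQ])
      finally have "(1 / (2 * r)) * norm (LBINT t:{-r..r}. D t) \<le> (1 / (2 * r)) *
         ((1/2) * ((LBINT t:{-r..r}. (cmod (p t - p0))\<^sup>2) + (LBINT t:{-r..r}. (cmod (q t - q0))\<^sup>2)))"
        using elim by (intro mult_left_mono) auto
      moreover have "norm (symmetric_mean D r) = (1 / (2 * r)) * norm (LBINT t:{-r..r}. D t)"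
        using elim by (simp add: symmetric_mean_def)
      ultimately have "norm (symmetric_mean D r) \<le> (1 / (2 * r)) *
         ((1/2) * ((LBINT t:{-r..r}. (cmod (p t - p0))\<^sup>2) + (LBINT t:{-r..r}. (cmod (q t - q0))\<^sup>2)))"
        by simp
      also have "\<dots> = (1/2) * (symmetric_mean (\<lambda>t. (cmod (p t - p0))\<^sup>2) r
          + symmetric_mean (\<lambda>t. (cmod (q t - q0))\<^sup>2) r)"
        unfolding symmetric_mean_def real_scaleR_def by (simp only: distrib_left mult.left_commute)
      finally show ?case .
    qed
  qed
  have eq: "p t * cnj (q t) = D t + (T (p t) + (U (q t) + (- p0 * cnj q0)))" for t
    by (simp add: D_def T_def U_def algebra_simps)
  have "((\<lambda>r. symmetric_mean D r + (T (symmetric_mean p r) + (U (symmetric_mean q r) + (- p0 * cnj q0))))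
      \<longlongrightarrow> 0 + (T p0 + (U q0 + (- p0 * cnj q0)))) (at_right 0)"
    using a b unfolding p_def q_def p0_def q0_def L2_mean_point_def
    by (intro tendsto_add limD[unfolded p_def q_def p0_def q0_def] bounded_linear.tendsto[OF T]
        bounded_linear.tendsto[OF U] tendsto_const) auto
  also have "0 + (T p0 + (U q0 + (- p0 * cnj q0))) = p0 * cnj q0"
    by (simp add: T_def U_def)
  finally have "(symmetric_mean (\<lambda>t. p t * cnj (q t)) \<longlongrightarrow> p0 * cnj q0) (at_right 0)"
  proof (rule Lim_transform_eventually)
    show "\<forall>\<^sub>F r in at_right 0. symmetric_mean D r + (T (symmetric_mean p r) + (U (symmetric_mean q r) + (- p0 * cnj q0)))
        = symmetric_mean (\<lambda>t. p t * cnj (q t)) r"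
      using eventually_at_right_less[of 0]
    proof eventually_elim
      case (elim r)
      note UQ = set_integrable_linear[OF U Q] and TP = set_integrable_linear[OF T P]
      note UQ' = set_integral_add(1)[OF UQ C]
      show ?case
        unfolding eq symmetric_mean_add[OF iD set_integral_add(1)[OF TP UQ']]
          symmetric_mean_add[OF TP UQ'] symmetric_mean_add[OF UQ C]
          symmetric_mean_linear[OF T P] symmetric_mean_linear[OF U Q] symmetric_mean_const[OF elim] ..
    qed
  qed
  then show ?thesis by (simp add: p_def q_def p0_def q0_def)
qed

section \<open>The fractional ambiguity function as a chirped ambiguity function\<close>

text \<open>This is \<open>1 + cot\<^sup>2 \<theta> = csc\<^sup>2 \<theta>\<close>.\<close>

lemma norm_Omega_squared:
  assumes "sin \<theta> \<noteq> 0"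
  shows "(cmod (Omega \<theta>))\<^sup>2 = \<bar>1 / sin \<theta>\<bar> / (2 * pi)"
proof -
  have "(cmod (1 - \<i> * complex_of_real (cot \<theta>)))\<^sup>2 = 1 + (cot \<theta>)\<^sup>2"
    by (simp add: cmod_power2)
  also have "\<dots> = ((sin \<theta>)\<^sup>2 + (cos \<theta>)\<^sup>2) / (sin \<theta>)\<^sup>2"
    using assms by (simp only: cot_def power_divide add_divide_distrib) simp
  also have "\<dots> = \<bar>1 / sin \<theta>\<bar>\<^sup>2"
    by (simp add: power_divide)
  finally have "cmod (1 - \<i> * complex_of_real (cot \<theta>)) = \<bar>1 / sin \<theta>\<bar>"
    by (rule power2_eq_imp_eq) auto
  then show ?thesis
    by (simp add: Omega_def norm_divide)
qed

text \<open>Multiplication of a signal by the linear chirp with rate \<open>\<gamma>\<close>, a unimodular quadratic phase.\<close>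

definition chirp :: "real \<Rightarrow> (real \<Rightarrow> complex) \<Rightarrow> real \<Rightarrow> complex" where
  "chirp \<gamma> x t = x t * exp (\<i> * complex_of_real (\<gamma> * t\<^sup>2 / 2))"

lemma norm_chirp: "cmod (chirp \<gamma> x t) = cmod (x t)"
  by (simp add: chirp_def norm_mult)

text \<open>The quadratic phases at \<open>a + t\<close> and \<open>-a + t\<close> differ by a linear phase.\<close>

lemma chirp_mult_cnj:
  "chirp \<gamma> x (a + t) * cnj (chirp \<gamma> x (- a + t))
     = x (t + a) * cnj (x (t - a)) * exp (\<i> * complex_of_real (2 * a * \<gamma> * t))"
proof -
  have "chirp \<gamma> x (a + t) * cnj (chirp \<gamma> x (- a + t)) = x (t + a) * cnj (x (t - a)) *
     exp (\<i> * complex_of_real (\<gamma> * (a + t)\<^sup>2 / 2) + cnj (\<i> * complex_of_real (\<gamma> * (- a + t)\<^sup>2 / 2)))"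
    unfolding chirp_def exp_add by (simp add: add.commute exp_cnj)
  also have "\<i> * complex_of_real (\<gamma> * (a + t)\<^sup>2 / 2) + cnj (\<i> * complex_of_real (\<gamma> * (- a + t)\<^sup>2 / 2))
     = \<i> * complex_of_real (2 * a * \<gamma> * t)"
    by (simp add: complex_eq_iff power2_eq_square field_simps)
  finally show ?thesis .
qed

lemma NFrAF_eq_Fourier_chirp:
  fixes k \<tau> \<theta> :: real
  assumes "sin \<theta> \<noteq> 0"
  defines "a \<equiv> k * (\<tau> / 2)"
  shows "NFrAF \<theta> k x \<tau> = (\<lambda>u. complex_of_real (\<bar>1 / sin \<theta>\<bar> / (2 * pi)) *
    (LBINT t. chirp (cot \<theta>) x (a + t) * cnj (chirp (cot \<theta>) x (- a + t)) *
       exp (- \<i> * complex_of_real (1 / sin \<theta> * t * u))))"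
proof
  fix u
  have "exp (\<i> * complex_of_real (t * (k * \<tau> * cot \<theta> - u * (1 / sin \<theta>))))
     = exp (\<i> * complex_of_real (2 * a * cot \<theta> * t)) * exp (- \<i> * complex_of_real (1 / sin \<theta> * t * u))" for t
    unfolding exp_add[symmetric] a_def
    by (intro arg_cong[of _ _ exp]) (simp add: complex_eq_iff algebra_simps)
  then show "NFrAF \<theta> k x \<tau> u = complex_of_real (\<bar>1 / sin \<theta>\<bar> / (2 * pi)) *
    (LBINT t. chirp (cot \<theta>) x (a + t) * cnj (chirp (cot \<theta>) x (- a + t)) *
       exp (- \<i> * complex_of_real (1 / sin \<theta> * t * u)))"
    unfolding NFrAF_def norm_Omega_squared[OF assms(1)] chirp_mult_cnj a_def[symmetric]
    by (simp only: mult.assoc)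
qed

theorem mainTheorem3:
  fixes x :: "real \<Rightarrow> complex" and k \<theta> :: real
  assumes "square_integrable x"
    and "k \<in> \<rat>" and "k > 0"
    and "\<forall>n::int. \<theta> \<noteq> of_int n * pi"
  shows "AE \<tau> in lborel.
    (integrable lborel (NFrAF \<theta> k x \<tau>) \<longrightarrow>
      (LBINT u. NFrAF \<theta> k x \<tau> u) = x (k * (\<tau> / 2)) * cnj (x (- (k * (\<tau> / 2))))) \<and>
    (\<forall>I. has_improper_integral (NFrAF \<theta> k x \<tau>) I \<longrightarrow>
      I = x (k * (\<tau> / 2)) * cnj (x (- (k * (\<tau> / 2))))) \<and>
    has_Abel_integral (NFrAF \<theta> k x \<tau>) (x (k * (\<tau> / 2)) * cnj (x (- (k * (\<tau> / 2)))))"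
proof -
  have sin: "sin \<theta> \<noteq> 0"
    using assms(4) by (auto simp: sin_zero_iff_int2)
  have [measurable]: "x \<in> borel_measurable borel"
    using assms(1) by (simp add: square_integrable_def)
  define y where "y = chirp (cot \<theta>) x"
  have y[measurable]: "y \<in> borel_measurable borel"
    unfolding y_def chirp_def[abs_def] by measurable
  have y2: "integrable lborel (\<lambda>t. (cmod (y t))\<^sup>2)"
    using assms(1) by (simp add: y_def norm_chirp square_integrable_def)
  \<comment> \<open>The exceptional \<open>\<tau>\<close> are the preimages of one null set under \<open>\<tau> \<mapsto> k \<tau> / 2\<close> and \<open>\<tau> \<mapsto> - k \<tau> / 2\<close>.\<close>
  have "AE \<tau> in lborel. L2_mean_point y (0 + k / 2 * \<tau>)"
    and "AE \<tau> in lborel. L2_mean_point y (0 + - (k / 2) * \<tau>)"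
    using assms(3) by (intro AE_lborel_affine[OF AE_L2_mean_point[OF y y2]]; simp)+
  then show ?thesis
  proof eventually_elim
    case (elim \<tau>)
    define a where "a = k * (\<tau> / 2)"
    have pts: "L2_mean_point y a" "L2_mean_point y (- a)"
      using elim by (simp_all add: a_def)
    have "has_Abel_integral (NFrAF \<theta> k x \<tau>) (y a * cnj (y (- a)))"
      unfolding NFrAF_eq_Fourier_chirp[OF sin] a_def[symmetric] y_def[symmetric]
    proof (rule Fourier_has_Abel_integral)
      show "integrable lborel (\<lambda>t. y (a + t) * cnj (y (- a + t)))"
        by (intro integrable_mult_cnj integrable_square_shift y2) measurable
    qed (use sin symmetric_mean_product_tendsto[OF y y2 pts] in auto)
    also have "y a * cnj (y (- a)) = x a * cnj (x (- a))"
      using chirp_mult_cnj[of "cot \<theta>" x a 0] by (simp add: y_def)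
    finally have "has_Abel_integral (NFrAF \<theta> k x \<tau>) (x a * cnj (x (- a)))" .
    then show ?case
      using has_improper_integral_unique_Abel integrable_imp_has_improper_integral
      unfolding a_def by blast
  qed
qed

end
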